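(* Let $\mathfrak M$ be a Hilbert space, $\mathcal E:=\mathbb C\setminus\{(-\infty,-1]\cup[1,+\infty)\}$, and let $a\in(-1,1)$, $a\neq0$. A function $\Omega\in\mathcal{RS}(\mathfrak M)$ satisfies the equality $$\Omega(z)=\left(\Omega\left(\frac{z-a}{1-az}\right)-aI_{\mathfrak M}\right)\left(I_{\mathfrak M}-a\,\Omega\left(\frac{z-a}{1-az}\right)\right)^{-1}$$ for all $z\in\mathcal E$ if and only if $\Omega$ is identically equal to a fundamental symmetry in $\mathfrak M$.
   Context: Hilbert spaces are complex and separable. A $\mathbf B(\mathfrak M)$-valued function $M$ is a Nevanlinna function if it is holomorphic outside the real axis, $M(\lambda)^*=M(\bar\lambda)$, and $\operatorname{Im}\lambda\,\operatorname{Im}M(\lambda)\ge0$ for all $\lambda\in\mathbb C\setminus\mathbb R$. The class $\mathcal{RS}(\mathfrak M)$ consists of all $\mathbf B(\mathfrak M)$-valued Nevanlinna functions $\Omega$ which are holomorphic on $\mathcal E$ and satisfy $-I\le\Omega(x)\le I$ for all $x\in(-1,1)$. A fundamental symmetry in $\mathfrak M$ is an operator $J\in\mathbf B(\mathfrak M)$ with $J=J^*=J^{-1}$. *)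

theory Defs
  imports "HOL-Analysis.Analysis"
begin

section \<open>Complex Hilbert spaces\<close>

text \<open>The inner product is linear in its first argument. Positive definiteness is contained in
  the axiom \<open>norm_eq_cinner\<close>, completeness in the superclass \<open>banach\<close>.\<close>

class chilbert_space = banach +
  fixes scaleC :: "complex \<Rightarrow> 'a \<Rightarrow> 'a"  (infixr \<open>*\<^sub>C\<close> 75)
    and cinner :: "'a \<Rightarrow> 'a \<Rightarrow> complex"
  assumes scaleC_add_right: "c *\<^sub>C (x + y) = c *\<^sub>C x + c *\<^sub>C y"
    and scaleC_add_left: "(c + d) *\<^sub>C x = c *\<^sub>C x + d *\<^sub>C x"
    and scaleC_scaleC: "c *\<^sub>C d *\<^sub>C x = (c * d) *\<^sub>C x"
    and scaleR_scaleC: "r *\<^sub>R x = complex_of_real r *\<^sub>C x"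
    and cinner_commute: "cinner x y = cnj (cinner y x)"
    and cinner_add_left: "cinner (x + y) z = cinner x z + cinner y z"
    and cinner_scaleC_left: "cinner (c *\<^sub>C x) y = c * cinner x y"
    and norm_eq_cinner: "cinner x x = complex_of_real ((norm x)\<^sup>2)"

lemma cinner_scaleC_right: "cinner x (c *\<^sub>C y) = cnj c * cinner x y"
  by (metis cinner_commute cinner_scaleC_left complex_cnj_mult)

lemma norm_scaleC: "norm (c *\<^sub>C x) = cmod c * norm x"
proof -
  have "complex_of_real ((norm (c *\<^sub>C x))\<^sup>2) = (c * cnj c) * complex_of_real ((norm x)\<^sup>2)"
    by (simp only: norm_eq_cinner[symmetric] cinner_scaleC_left cinner_scaleC_right mult_ac)
  also have "\<dots> = complex_of_real ((cmod c * norm x)\<^sup>2)"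
    by (simp add: complex_norm_square[symmetric] power_mult_distrib)
  finally have "(norm (c *\<^sub>C x))\<^sup>2 = (cmod c * norm x)\<^sup>2"
    by (simp only: of_real_eq_iff)
  then show ?thesis
    by (simp add: power2_eq_iff_nonneg)
qed

lemma bounded_linear_scaleC: "bounded_linear (\<lambda>x. c *\<^sub>C x)"
  by (rule bounded_linear_intro[where K = "cmod c"])
    (simp_all add: scaleC_add_right scaleR_scaleC scaleC_scaleC norm_scaleC mult.commute)

section \<open>Bounded operators\<close>

text \<open>Elements of \<open>'a \<Rightarrow>\<^sub>L 'a\<close> are only real-linear. The algebra \<open>B(M)\<close> consists of the
  complex-linear ones; it carries the operator norm of \<open>'a \<Rightarrow>\<^sub>L 'a\<close>.\<close>

definition bounded_ops :: "('a::chilbert_space \<Rightarrow>\<^sub>L 'a) set"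
  where "bounded_ops = {A :: 'a \<Rightarrow>\<^sub>L 'a. \<forall>c x. A (c *\<^sub>C x) = c *\<^sub>C A x}"

lift_definition op_scaleC :: "complex \<Rightarrow> ('a::chilbert_space \<Rightarrow>\<^sub>L 'a) \<Rightarrow> ('a \<Rightarrow>\<^sub>L 'a)"
  is "\<lambda>c A x. c *\<^sub>C A x"
  by (rule bounded_linear_compose[OF bounded_linear_scaleC])

text \<open>Existence of the adjoint of an element of \<open>bounded_ops\<close> is the Riesz representation
  theorem; uniqueness is immediate.\<close>

definition op_adjoint :: "('a::chilbert_space \<Rightarrow>\<^sub>L 'a) \<Rightarrow> ('a \<Rightarrow>\<^sub>L 'a)"
  where "op_adjoint A = (THE B. B \<in> bounded_ops \<and> (\<forall>x y. cinner (A x) y = cinner x (B y)))"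

definition op_Im :: "('a::chilbert_space \<Rightarrow>\<^sub>L 'a) \<Rightarrow> ('a \<Rightarrow>\<^sub>L 'a)"
  where "op_Im A = op_scaleC (1 / (2 * \<i>)) (A - op_adjoint A)"

definition op_le :: "('a::chilbert_space \<Rightarrow>\<^sub>L 'a) \<Rightarrow> ('a \<Rightarrow>\<^sub>L 'a) \<Rightarrow> bool"
  where "op_le A B \<longleftrightarrow> (\<forall>x. cinner ((B - A) x) x \<in> \<real>\<^sub>\<ge>\<^sub>0)"

definition is_op_inverse :: "('a::chilbert_space \<Rightarrow>\<^sub>L 'a) \<Rightarrow> ('a \<Rightarrow>\<^sub>L 'a) \<Rightarrow> bool"
  where "is_op_inverse A B \<longleftrightarrow>
    B \<in> bounded_ops \<and> A o\<^sub>L B = id_blinfun \<and> B o\<^sub>L A = id_blinfun"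

definition op_invertible :: "('a::chilbert_space \<Rightarrow>\<^sub>L 'a) \<Rightarrow> bool"
  where "op_invertible A \<longleftrightarrow> (\<exists>B. is_op_inverse A B)"

text \<open>The value is meaningful only when \<open>op_invertible A\<close> holds.\<close>

definition op_inverse :: "('a::chilbert_space \<Rightarrow>\<^sub>L 'a) \<Rightarrow> ('a \<Rightarrow>\<^sub>L 'a)"
  where "op_inverse A = (THE B. is_op_inverse A B)"

definition fundamental_symmetry :: "('a::chilbert_space \<Rightarrow>\<^sub>L 'a) \<Rightarrow> bool"
  where "fundamental_symmetry J \<longleftrightarrow>
    J \<in> bounded_ops \<and> J = op_adjoint J \<and> op_invertible J \<and> J = op_inverse J"

section \<open>Nevanlinna functions and the class RS\<close>

text \<open>Holomorphy of a \<open>B(M)\<close>-valued function with respect to the operator norm. The library's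
  \<open>holomorphic_on\<close> only covers functions with values in the scalar field.\<close>

definition op_holomorphic_on :: "(complex \<Rightarrow> ('a::chilbert_space \<Rightarrow>\<^sub>L 'a)) \<Rightarrow> complex set \<Rightarrow> bool"
  where "op_holomorphic_on F S \<longleftrightarrow>
    (\<forall>z\<in>S. F z \<in> bounded_ops) \<and>
    (\<forall>z\<in>S. \<exists>D\<in>bounded_ops.
       ((\<lambda>w. op_scaleC (1 / (w - z)) (F w - F z)) \<longlongrightarrow> D) (at z within S))"

definition nevanlinna :: "(complex \<Rightarrow> ('a::chilbert_space \<Rightarrow>\<^sub>L 'a)) \<Rightarrow> bool"
  where "nevanlinna M \<longleftrightarrow>
    op_holomorphic_on M (- \<real>) \<and>
    (\<forall>z. z \<notin> \<real> \<longrightarrow> op_adjoint (M z) = M (cnj z)) \<and>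
    (\<forall>z. z \<notin> \<real> \<longrightarrow> op_le 0 (Im z *\<^sub>R op_Im (M z)))"

definition slit_plane :: "complex set"
  where "slit_plane = UNIV - complex_of_real ` ({..-1} \<union> {1..})"

text \<open>Functions are total in HOL; only the values on \<open>slit_plane\<close> are constrained.\<close>

definition RS :: "(complex \<Rightarrow> ('a::chilbert_space \<Rightarrow>\<^sub>L 'a)) set"
  where "RS = {\<Omega>. nevanlinna \<Omega> \<and> op_holomorphic_on \<Omega> slit_plane \<and>
    (\<forall>x::real. x \<in> {-1<..<1} \<longrightarrow>
       op_le (- id_blinfun) (\<Omega> (of_real x)) \<and> op_le (\<Omega> (of_real x)) id_blinfun)}"

end

(* Only the equation at z = a is needed. It expresses S = \<Omega>(a) through T = \<Omega>(0) as
   S = (T - a)(I - aT)^{-1}, so that S - T = -a (I - T^2)(I - aT)^{-1}. As \<Omega> is monotone on (-1,1),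
   a (S - T) is nonnegative, whereas the right-hand side makes it nonpositive; hence T^2 = I and
   S = T. By monotonicity \<Omega> is constant between 0 and a, and by the identity theorem everywhere. *)
theory Submission
  imports Defs "HOL-Complex_Analysis.Complex_Analysis"
begin

section \<open>Quadratic forms of bounded operators\<close>

lemma cinner_add_right: "cinner x (y + z) = cinner x y + cinner x z"
  by (metis cinner_add_left cinner_commute complex_cnj_add)

lemma scaleC_minus_one: "(-1) *\<^sub>C x = - x"
  using scaleR_scaleC[of "-1" x] by simp

lemma cinner_minus_left: "cinner (- x) y = - cinner x y"
  using cinner_scaleC_left[of "-1" x y] by (simp add: scaleC_minus_one)

lemma cinner_minus_right: "cinner x (- y) = - cinner x y"
  using cinner_scaleC_right[of x "-1" y] by (simp add: scaleC_minus_one)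

lemma cinner_diff_left: "cinner (x - y) z = cinner x z - cinner y z"
  using cinner_add_left[of x "- y" z] by (simp add: cinner_minus_left)

lemma cinner_diff_right: "cinner x (y - z) = cinner x y - cinner x z"
  using cinner_add_right[of x y "- z"] by (simp add: cinner_minus_right)

lemma cinner_scaleR_left: "cinner (r *\<^sub>R x) y = of_real r * cinner x y"
  by (simp add: scaleR_scaleC cinner_scaleC_left)

lemma cinner_scaleR_right: "cinner x (r *\<^sub>R y) = of_real r * cinner x y"
  by (simp add: scaleR_scaleC cinner_scaleC_right)

lemma cinner_zero_left [simp]: "cinner 0 x = 0"
  using cinner_scaleR_left[of 0 0 x] by simp

lemma cinner_eq_zero_iff [simp]: "cinner x x = 0 \<longleftrightarrow> x = 0"
  by (simp add: norm_eq_cinner)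

lemmas cinner_simps = cinner_add_left cinner_add_right cinner_diff_left cinner_diff_right
  cinner_scaleR_left cinner_scaleR_right cinner_scaleC_left cinner_scaleC_right
  cinner_minus_left cinner_minus_right

text \<open>Writing the inner product through norms lets its continuity be inherited from that of
  the norm.\<close>

lemma Re_cinner_polarization: "Re (cinner x y) = ((norm (x + y))\<^sup>2 - (norm (x - y))\<^sup>2) / 4"
proof -
  have "complex_of_real ((norm (x + y))\<^sup>2 - (norm (x - y))\<^sup>2) = 2 * (cinner x y + cnj (cinner x y))"
    unfolding of_real_diff norm_eq_cinner[symmetric]
    using cinner_commute[of y x] by (simp add: cinner_simps)
  then show ?thesis
    by (simp only: complex_add_cnj complex_eq_iff) simp
qed

text \<open>Real parts converge by polarization. Imaginary parts reduce to real parts, since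
  replacing \<open>y\<close> by \<open>\<i> *\<^sub>C y\<close> multiplies the inner product by
  \<open>-\<i>\<close>.\<close>

lemma tendsto_cinner_left:
  assumes "(f \<longlongrightarrow> l) F"
  shows "((\<lambda>w. cinner (f w) y) \<longlongrightarrow> cinner l y) F"
proof -
  have *: "((\<lambda>w. Re (cinner (f w) v)) \<longlongrightarrow> Re (cinner l v)) F" for v
    unfolding Re_cinner_polarization by (intro tendsto_intros assms) simp
  show ?thesis
    using *[of y] *[of "\<i> *\<^sub>C y"] by (simp add: tendsto_complex_iff cinner_scaleC_right)
qed

section \<open>Complex-linear operators and their quadratic forms\<close>

lemma bounded_ops_scaleC: "A \<in> bounded_ops \<Longrightarrow> A (c *\<^sub>C x) = c *\<^sub>C A x"
  by (simp add: bounded_ops_def)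

lemma id_bounded_ops: "id_blinfun \<in> bounded_ops"
  by (simp add: bounded_ops_def)

lemma scaleC_diff_right: "c *\<^sub>C (x - y) = c *\<^sub>C x - c *\<^sub>C y"
  by (metis add_diff_cancel diff_add_cancel scaleC_add_right)

lemma scaleC_scaleR_commute: "c *\<^sub>C r *\<^sub>R x = r *\<^sub>R c *\<^sub>C x"
  by (simp add: scaleR_scaleC scaleC_scaleC mult.commute)

lemma add_bounded_ops: "A \<in> bounded_ops \<Longrightarrow> B \<in> bounded_ops \<Longrightarrow> A + B \<in> bounded_ops"
  by (simp add: bounded_ops_def blinfun.add_left scaleC_add_right)

lemma diff_bounded_ops: "A \<in> bounded_ops \<Longrightarrow> B \<in> bounded_ops \<Longrightarrow> A - B \<in> bounded_ops"
  by (simp add: bounded_ops_def blinfun.diff_left scaleC_diff_right)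

lemma scaleR_bounded_ops: "A \<in> bounded_ops \<Longrightarrow> r *\<^sub>R A \<in> bounded_ops"
  by (simp add: bounded_ops_def blinfun.scaleR_left scaleC_scaleR_commute)

lemma bounded_op_eqI_form:
  assumes "A \<in> bounded_ops" "B \<in> bounded_ops" and eq: "\<And>x. cinner (A x) x = cinner (B x) x"
  shows "A = B"
proof -
  define D where "D = A - B"
  have D: "D \<in> bounded_ops"
    unfolding D_def by (rule diff_bounded_ops) fact+
  have 0: "cinner (D x) x = 0" for x
    by (simp add: D_def blinfun.diff_left cinner_diff_left eq)
  \<comment> \<open>Expanding the form at \<open>x + y\<close> shows that the two mixed terms have
    sum zero. Expanding it at \<open>x + \<i> *\<^sub>C y\<close> shows that they are equal.\<close>
  have "cinner (D x) y = 0" for x y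
    using 0[of "x + y"] 0[of "x + \<i> *\<^sub>C y"] 0[of x] 0[of y]
    by (simp add: blinfun.add_right bounded_ops_scaleC[OF D] cinner_simps algebra_simps)
  then have "D x = 0" for x
    using cinner_eq_zero_iff by blast
  then show ?thesis
    by (auto simp: D_def blinfun.diff_left intro!: blinfun_eqI)
qed

text \<open>Polarization again: realness at \<open>x + y\<close> and at
  \<open>x + \<i> *\<^sub>C y\<close> says that \<open>cinner (A x) y\<close> and
  \<open>cinner (A y) x\<close> have opposite imaginary and equal real parts, so they are
  conjugate.\<close>

lemma symmetric_if_form_real:
  assumes "A \<in> bounded_ops" and real: "\<And>x. cinner (A x) x \<in> \<real>"
  shows "cinner (A x) y = cinner x (A y)"
proof -
  have "Im (cinner (A x) y + cinner (A y) x) = 0"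
    using real[of "x + y"] real[of x] real[of y]
    by (simp add: blinfun.add_right cinner_simps complex_is_Real_iff)
  moreover have "Re (cinner (A y) x - cinner (A x) y) = 0"
    using real[of "x + \<i> *\<^sub>C y"] real[of x] real[of y]
    by (simp add: blinfun.add_right bounded_ops_scaleC[OF assms(1)] cinner_simps complex_is_Real_iff)
  ultimately show ?thesis
    using cinner_commute[of x "A y"] by (simp add: complex_eq_iff)
qed

text \<open>Any two candidates for the adjoint have the same quadratic form and therefore coincide,
  so the definite description picks out \<open>B\<close>.\<close>

lemma op_adjoint_eqI:
  fixes A :: "'a::chilbert_space \<Rightarrow>\<^sub>L 'a"
  assumes "B \<in> bounded_ops" and "\<And>x y. cinner (A x) y = cinner x (B y)"
  shows "op_adjoint A = B"
  unfolding op_adjoint_def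
proof (rule the_equality)
  fix C assume C: "C \<in> bounded_ops \<and> (\<forall>x y. cinner (A x) y = cinner x (C y))"
  have "cinner (C x) x = cinner (B x) x" for x
    using C assms(2) by (metis cinner_commute)
  then show "C = B"
    using C assms(1) bounded_op_eqI_form by blast
qed (use assms in blast)

lemma op_inverse_eqI:
  assumes "is_op_inverse A B"
  shows "op_inverse A = B"
  unfolding op_inverse_def
proof (rule the_equality)
  show "is_op_inverse A B"
    by fact
  fix C assume "is_op_inverse A C"
  then show "C = B"
    using assms unfolding is_op_inverse_def
    by (metis blinfun_apply_blinfun_compose blinfun_apply_id_blinfun blinfun_eqI)
qed

section \<open>Selfadjoint contractions\<close>

text \<open>The order bounds are the form in which \<open>RS\<close> supplies the information. Since
  \<open>op_le\<close> demands real nonnegative forms, they yield both symmetry and the norm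
  bound.\<close>

locale selfadjoint_contraction =
  fixes T :: "'a::chilbert_space \<Rightarrow>\<^sub>L 'a"
  assumes bounded_op: "T \<in> bounded_ops"
    and lower: "op_le (- id_blinfun) T"
    and upper: "op_le T id_blinfun"
begin

lemma form_real: "cinner (T x) x \<in> \<real>"
proof -
  have "cinner x x - cinner (T x) x \<in> \<real>"
    using upper nonneg_Reals_subset_Reals
    by (auto simp: op_le_def blinfun.diff_left cinner_diff_left)
  then show ?thesis
    by (simp add: norm_eq_cinner complex_is_Real_iff)
qed

lemma symmetric: "cinner (T x) y = cinner x (T y)"
  by (rule symmetric_if_form_real[OF bounded_op form_real])

text \<open>With \<open>A = I - T\<close> and \<open>B = I + T\<close> one has \<open>2 (I - T\<^sup>2) = A B A + B A B\<close>.\<close>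

lemma norm_apply_le: "norm (T x) \<le> norm x"
proof -
  have A: "0 \<le> Re (cinner (u - T u) u)" for u
    using upper by (simp add: op_le_def blinfun.diff_left complex_nonneg_Reals_iff)
  have B: "0 \<le> Re (cinner (u + T u) u)" for u
    using lower
    by (simp add: op_le_def blinfun.add_left blinfun.diff_left blinfun.minus_left complex_nonneg_Reals_iff add.commute)
  define p q where "p = x - T x" and "q = x + T x"
  have "cinner (q - T q) q + cinner (p + T p) p = 2 * (cinner x x - cinner (T x) (T x))"
    unfolding p_def q_def blinfun.add_right blinfun.diff_right
    by (simp add: cinner_simps symmetric algebra_simps)
  also have "\<dots> = complex_of_real (2 * ((norm x)\<^sup>2 - (norm (T x))\<^sup>2))"
    by (simp add: norm_eq_cinner)
  finally have "Re (cinner (q - T q) q) + Re (cinner (p + T p) p) = 2 * ((norm x)\<^sup>2 - (norm (T x))\<^sup>2)"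
    by (metis Re_complex_of_real plus_complex.sel(1))
  then have "0 \<le> 2 * ((norm x)\<^sup>2 - (norm (T x))\<^sup>2)"
    using add_nonneg_nonneg[OF A[of q] B[of p]] by (simp only:)
  then have "(norm (T x))\<^sup>2 \<le> (norm x)\<^sup>2"
    by simp
  then show ?thesis
    by (simp add: power2_le_iff_abs_le)
qed

text \<open>The norm of \<open>a *\<^sub>R T\<close> is at most \<open>\<bar>a\<bar> < 1\<close>.
  Hence \<open>I - aT\<close> is bounded below, which gives injectivity and a bound for the inverse,
  and solving \<open>y - aTy = x\<close> is a fixed point problem for a contraction.\<close>

lemma resolvent_invertible:
  assumes "\<bar>a\<bar> < 1"
  shows "op_invertible (id_blinfun - a *\<^sub>R T)"
proof -
  define A where "A = id_blinfun - a *\<^sub>R T"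
  have A_apply: "A x = x - a *\<^sub>R T x" for x
    by (simp add: A_def blinfun.diff_left blinfun.scaleR_left)
  have A_op: "A \<in> bounded_ops"
    unfolding A_def by (intro diff_bounded_ops scaleR_bounded_ops id_bounded_ops bounded_op)
  have bound: "(1 - \<bar>a\<bar>) * norm x \<le> norm (A x)" for x
  proof -
    have "norm (a *\<^sub>R T x) \<le> \<bar>a\<bar> * norm x"
      by (simp add: mult_left_mono norm_apply_le)
    then show ?thesis
      using norm_triangle_ineq2[of x "a *\<^sub>R T x"] by (simp add: A_apply algebra_simps)
  qed
  have inj: "x = y" if "A x = A y" for x y
    using bound[of "x - y"] that assms by (simp add: blinfun.diff_right mult_le_0_iff)
  have "\<exists>y. A y = x" for x
  proof -
    have "\<exists>!y. x + a *\<^sub>R T y = y"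
    proof (rule banach_fix_type[of "\<bar>a\<bar>"])
      show "\<forall>u v. dist (x + a *\<^sub>R T u) (x + a *\<^sub>R T v) \<le> \<bar>a\<bar> * dist u v"
      proof (intro allI)
        fix u v
        have "norm (a *\<^sub>R T (u - v)) \<le> \<bar>a\<bar> * norm (u - v)"
          by (simp add: mult_left_mono norm_apply_le)
        then show "dist (x + a *\<^sub>R T u) (x + a *\<^sub>R T v) \<le> \<bar>a\<bar> * dist u v"
          by (simp add: dist_norm blinfun.diff_right algebra_simps)
      qed
    qed (use assms in auto)
    then show ?thesis
      by (metis A_apply add_diff_cancel_right')
  qed
  then obtain R where R: "\<And>x. A (R x) = x"
    by metis
  \<comment> \<open>Each algebraic law for \<open>R\<close> is checked after applying
    \<open>A\<close>, which is injective and undoes \<open>R\<close>.\<close>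
  have R_lin: "bounded_linear R"
  proof (rule bounded_linear_intro[where K = "1 / (1 - \<bar>a\<bar>)"])
    show "R (x + y) = R x + R y" for x y
      by (rule inj) (simp add: R blinfun.add_right)
    show "R (r *\<^sub>R x) = r *\<^sub>R R x" for r x
      by (rule inj) (simp add: R blinfun.scaleR_right)
    show "norm (R x) \<le> norm x * (1 / (1 - \<bar>a\<bar>))" for x
      using bound[of "R x"] assms by (simp add: R field_simps)
  qed
  have R_apply: "Blinfun R x = R x" for x
    by (simp add: bounded_linear_Blinfun_apply[OF R_lin])
  have "R (c *\<^sub>C x) = c *\<^sub>C R x" for c x
    by (rule inj) (simp add: R bounded_ops_scaleC[OF A_op])
  then have "Blinfun R \<in> bounded_ops"
    by (simp add: bounded_ops_def R_apply)
  moreover have "A o\<^sub>L Blinfun R = id_blinfun"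
    by (rule blinfun_eqI) (simp add: R_apply R)
  moreover have "Blinfun R o\<^sub>L A = id_blinfun"
    by (rule blinfun_eqI, rule inj) (simp add: R_apply R)
  ultimately have "is_op_inverse A (Blinfun R)"
    unfolding is_op_inverse_def by blast
  then show ?thesis
    unfolding op_invertible_def A_def by blast
qed

lemma op_adjoint_eq: "op_adjoint T = T"
  by (rule op_adjoint_eqI[OF bounded_op symmetric])

lemma fundamental_symmetry_if_involution:
  assumes "\<And>x. T (T x) = x"
  shows "fundamental_symmetry T"
proof -
  have "is_op_inverse T T"
    unfolding is_op_inverse_def by (auto simp: bounded_op assms intro!: blinfun_eqI)
  then show ?thesis
    unfolding fundamental_symmetry_def op_invertible_def
    using bounded_op op_adjoint_eq op_inverse_eqI by metis
qed

text \<open>The form \<open>q(u,v) = \<langle>(I - T\<^sup>2)u, v\<rangle>\<close> is positive semidefinite and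
  \<open>q(u,u) - q(Tu,Tu) = \<parallel>(I - T\<^sup>2)u\<parallel>\<^sup>2\<close>, so \<open>\<bar>Re q(u,Tu)\<bar> \<le> q(u,u)\<close>. The hypothesis
  \<open>q(u,u) - a Re q(u,Tu) \<le> 0\<close> hence forces \<open>q(u,u) = 0\<close>.\<close>

lemma involution_if_defect_nonpos:
  assumes a: "\<bar>a\<bar> < 1"
    and nonpos: "\<And>u. Re (cinner (u - T (T u)) (u - a *\<^sub>R T u)) \<le> 0"
  shows "T (T x) = x"
proof -
  define q where "q u v = Re (cinner (u - T (T u)) v)" for u v
  have q_diag: "q u u = (norm u)\<^sup>2 - (norm (T u))\<^sup>2" for u
  proof -
    have "cinner (u - T (T u)) u = complex_of_real ((norm u)\<^sup>2 - (norm (T u))\<^sup>2)"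
      unfolding of_real_diff norm_eq_cinner[symmetric] by (simp add: cinner_diff_left symmetric)
    then show ?thesis
      by (simp add: q_def)
  qed
  have q_pos: "0 \<le> q u u" for u
    using norm_apply_le[of u] by (simp add: q_diag power_mono)
  have q_sym: "q (T u) u = q u (T u)" for u
    by (simp add: q_def cinner_diff_left symmetric)
  have defect: "q u u - q (T u) (T u) = (norm (u - T (T u)))\<^sup>2" for u
  proof -
    have "complex_of_real (q u u - q (T u) (T u)) = complex_of_real ((norm (u - T (T u)))\<^sup>2)"
      unfolding q_diag of_real_diff norm_eq_cinner[symmetric]
      by (simp add: cinner_simps symmetric)
    then show ?thesis
      using of_real_eq_iff by blast
  qed
  \<comment> \<open>Both left-hand sides are nonnegative, so 2|q(u,Tu)| is at most q(u,u) +
    q(Tu,Tu), which by \<open>defect\<close> is at most 2q(u,u).\<close>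
  have "q (u + T u) (u + T u) = q u u + 2 * q u (T u) + q (T u) (T u)"
    and "q (u - T u) (u - T u) = q u u - 2 * q u (T u) + q (T u) (T u)" for u
    using q_sym[of u] by (simp_all add: q_def blinfun.add_right blinfun.diff_right cinner_simps)
  then have "\<bar>q u (T u)\<bar> \<le> q u u" for u
    using q_pos[of "u + T u"] q_pos[of "u - T u"] defect[of u] zero_le_power2[of "norm (u - T (T u))"]
    by (smt (verit))
  then have "\<bar>a * q u (T u)\<bar> \<le> \<bar>a\<bar> * q u u" for u
    by (simp add: abs_mult mult_left_mono)
  then have 1: "a * q u (T u) \<le> \<bar>a\<bar> * q u u" for u
    by (rule order_trans[OF abs_ge_self])
  have 2: "q u u - a * q u (T u) \<le> 0" for u
    using nonpos[of u] by (simp add: q_def cinner_simps)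
  have "(1 - \<bar>a\<bar>) * q u u \<le> 0" for u
    using 1[of u] 2[of u] by (simp add: left_diff_distrib)
  then have "q u u = 0" for u
    using q_pos[of u] a by (simp add: mult_le_0_iff order_antisym)
  then show ?thesis
    using defect[of x] by simp
qed

end

section \<open>The slit plane\<close>

lemma slit_plane_iff: "z \<in> slit_plane \<longleftrightarrow> (z \<in> \<real> \<longrightarrow> cmod z < 1)"
proof (cases "z \<in> \<real>")
  case True
  then obtain r where "z = of_real r"
    by (auto elim: Reals_cases)
  then show ?thesis
    by (auto simp: slit_plane_def)
next
  case False
  then show ?thesis
    by (auto simp: slit_plane_def)
qed

lemma of_real_slit_plane_iff [simp]: "of_real x \<in> slit_plane \<longleftrightarrow> \<bar>x\<bar> < 1"
  by (simp add: slit_plane_iff)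

lemma open_slit_plane: "open slit_plane"
proof -
  have *: "- slit_plane = \<real> \<inter> {z. 1 \<le> cmod z}"
    by (auto simp: slit_plane_iff)
  show ?thesis
    unfolding open_closed *
    by (intro closed_Int closed_complex_Reals closed_Collect_le continuous_intros)
qed

text \<open>The set is starlike about 0: a factor in (0,1] keeps nonreal points nonreal and does not
  increase the modulus of real ones.\<close>

lemma connected_slit_plane: "connected slit_plane"
proof (rule starlike_imp_connected)
  have "closed_segment 0 z \<subseteq> slit_plane" if "z \<in> slit_plane" for z
  proof
    fix w assume "w \<in> closed_segment 0 z"
    then obtain t where t: "0 \<le> t" "t \<le> 1" "w = of_real t * z"
      by (auto simp: in_segment scaleR_conv_of_real)
    show "w \<in> slit_plane"
    proof (cases "t = 0 \<or> z \<in> \<real>")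
      case True
      moreover have "t * cmod z \<le> cmod z"
        using t by (simp add: mult_left_le_one_le)
      ultimately show ?thesis
        using that t by (auto simp: slit_plane_iff norm_mult)
    next
      case False
      then show ?thesis
        using t by (auto simp: slit_plane_iff complex_is_Real_iff)
    qed
  qed
  moreover have "0 \<in> slit_plane"
    by (simp add: slit_plane_iff)
  ultimately show "starlike slit_plane"
    unfolding starlike_def by blast
qed

text \<open>The map has real coefficients and determinant \<open>1 - a\<^sup>2\<close>, which is
  nonzero. It therefore keeps nonreal points nonreal, and it maps (-1,1) into itself.\<close>

lemma moebius_slit_plane:
  assumes a: "\<bar>a\<bar> < 1" and z: "z \<in> slit_plane"
  shows "(z - of_real a) / (1 - of_real a * z) \<in> slit_plane"
proof -
  have "a\<^sup>2 < 1"
    using a by (simp add: abs_square_less_1)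
  show ?thesis
  proof (cases "z \<in> \<real>")
    case True
    then obtain x where x: "z = of_real x"
      by (auto elim: Reals_cases)
    have x1: "\<bar>x\<bar> < 1"
      using z by (simp add: x)
    then have "\<bar>a\<bar> * \<bar>x\<bar> \<le> \<bar>a\<bar> * 1"
      by (intro mult_left_mono) auto
    then have "\<bar>a * x\<bar> < 1"
      using a by (simp add: abs_mult)
    then have pos: "0 < 1 - a * x"
      by linarith
    \<comment> \<open>Expanded, the two products give a - x < 1 - ax and x - a < 1 - ax.\<close>
    have "0 < (1 - a) * (1 + x)" "0 < (1 + a) * (1 - x)"
      using a x1 by (auto intro!: mult_pos_pos)
    then have "\<bar>x - a\<bar> < 1 - a * x"
      by (simp add: algebra_simps abs_less_iff)
    then have "\<bar>(x - a) / (1 - a * x)\<bar> < 1"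
      using pos by (simp add: abs_less_iff field_simps)
    moreover have "(z - of_real a) / (1 - of_real a * z) = of_real ((x - a) / (1 - a * x))"
      by (simp add: x)
    ultimately show ?thesis
      by (simp only: of_real_slit_plane_iff)
  next
    case False
    have "Im ((z - of_real a) / (1 - of_real a * z)) \<noteq> 0"
    proof
      \<comment> \<open>A real value r would give z(1 + ra) = r + a. As z is nonreal, both 1 + ra
        and r + a vanish, whence \<open>a\<^sup>2 = 1\<close>.\<close>
      assume im: "Im ((z - of_real a) / (1 - of_real a * z)) = 0"
      define r where "r = Re ((z - of_real a) / (1 - of_real a * z))"
      have r: "(z - of_real a) / (1 - of_real a * z) = of_real r"
        using im by (simp add: r_def complex_eq_iff)
      have "1 - of_real a * z \<noteq> 0"
        using False by (auto simp: complex_is_Real_iff complex_eq_iff)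
      then have "z - of_real a = of_real r * (1 - of_real a * z)"
        using r by (simp add: field_simps)
      then have *: "z * of_real (1 + r * a) = of_real (r + a)"
        by (simp add: algebra_simps)
      then have "Im (z * of_real (1 + r * a)) = 0"
        by (simp only: Im_complex_of_real)
      then have "Im z * (1 + r * a) = 0"
        by simp
      then have ra: "1 + r * a = 0"
        using False by (simp add: complex_is_Real_iff)
      have "of_real (r + a) = (0 :: complex)"
        using *[symmetric] unfolding ra by simp
      then have "r = - a"
        by (simp only: of_real_eq_0_iff add_eq_0_iff2)
      then show False
        using ra \<open>a\<^sup>2 < 1\<close> by (simp add: power2_eq_square)
    qed
    then show ?thesis
      by (simp add: slit_plane_iff complex_is_Real_iff)
  qed
qed

section \<open>The class RS\<close>

text \<open>Evaluating the operator limit at \<open>h\<close> and pairing with \<open>h\<close> is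
  continuous. This passes from operator-valued functions to scalar ones, to which classical complex
  analysis applies.\<close>

lemma op_holomorphic_on_form:
  assumes "op_holomorphic_on F S"
  shows "(\<lambda>z. cinner (F z h) h) holomorphic_on S"
  unfolding holomorphic_on_def
proof
  fix z assume "z \<in> S"
  with assms obtain D where D: "((\<lambda>w. op_scaleC (1 / (w - z)) (F w - F z)) \<longlongrightarrow> D) (at z within S)"
    unfolding op_holomorphic_on_def by blast
  then have "((\<lambda>w. op_scaleC (1 / (w - z)) (F w - F z) h) \<longlongrightarrow> D h) (at z within S)"
    by (intro tendsto_intros)
  then have "((\<lambda>w. cinner (op_scaleC (1 / (w - z)) (F w - F z) h) h) \<longlongrightarrow> cinner (D h) h) (at z within S)"
    by (rule tendsto_cinner_left)
  then have "((\<lambda>z. cinner (F z h) h) has_field_derivative cinner (D h) h) (at z within S)"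
    unfolding has_field_derivative_iff
    by (simp add: op_scaleC.rep_eq blinfun.diff_left cinner_scaleC_left cinner_diff_left)
  then show "(\<lambda>z. cinner (F z h) h) field_differentiable at z within S"
    unfolding field_differentiable_def by blast
qed

lemma RS_form_holomorphic:
  assumes "\<Omega> \<in> RS"
  shows "(\<lambda>z. cinner (\<Omega> z h) h) holomorphic_on slit_plane"
  using assms op_holomorphic_on_form unfolding RS_def by blast

lemma RS_selfadjoint_contraction:
  assumes "\<Omega> \<in> RS" "\<bar>x\<bar> < 1"
  shows "selfadjoint_contraction (\<Omega> (of_real x))"
  using assms by unfold_locales (auto simp: RS_def op_holomorphic_on_def abs_less_iff)

lemma RS_bounded_ops: "\<Omega> \<in> RS \<Longrightarrow> z \<in> slit_plane \<Longrightarrow> \<Omega> z \<in> bounded_ops"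
  by (simp add: RS_def op_holomorphic_on_def)

text \<open>The symmetric difference quotient in the imaginary direction turns the positivity of
  \<open>Im \<Omega>\<close> into positivity of the derivative on the real axis, without appeal to
  \<open>\<langle>A\<^sup>*h, h\<rangle> = cnj \<langle>A h, h\<rangle>\<close>, which would require existence of the adjoint.\<close>

lemma RS_form_deriv_nonneg:
  assumes \<Omega>: "\<Omega> \<in> RS"
    and D: "((\<lambda>z. cinner (\<Omega> z h) h) has_field_derivative D) (at (of_real x))"
  shows "0 \<le> Re D"
proof -
  define f where "f z = cinner (\<Omega> z h) h" for z
  \<comment> \<open>The vertical line through \<open>x\<close>, with a complex parameter so that the
    chain rule applies directly; its derivative at 0 is \<open>D * \<i>\<close>.\<close>
  define g where "g y = f (of_real x + \<i> * y)" for y :: complex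
  have "(f has_field_derivative D) (at (of_real x + \<i> * 0))"
    using D by (simp add: f_def[abs_def])
  then have "(g has_field_derivative D * \<i>) (at 0)"
    unfolding g_def by (rule DERIV_chain2) (auto intro!: derivative_eq_intros)
  then have lim: "((\<lambda>y. (g y - g 0) / y) \<longlongrightarrow> D * \<i>) (at 0)"
    by (simp add: has_field_derivative_iff)
  have p: "filterlim (\<lambda>y. complex_of_real y) (at 0) (at_right 0)"
    by (intro filterlim_atI tendsto_eq_intros) (auto simp: eventually_at_filter)
  have m: "filterlim (\<lambda>y. complex_of_real (- y)) (at 0) (at_right 0)"
    by (intro filterlim_atI tendsto_eq_intros) (auto simp: eventually_at_filter)
  \<comment> \<open>The terms with \<open>g 0\<close> cancel: the sum is (g(y) - g(-y))/y, which
    compares conjugate points and tends to \<open>2 * \<i> * D\<close>.\<close>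
  have "((\<lambda>y. (g (of_real y) - g 0) / of_real y + (g (of_real (- y)) - g 0) / of_real (- y))
      \<longlongrightarrow> D * \<i> + D * \<i>) (at_right 0)"
    by (intro tendsto_add filterlim_compose[OF lim p] filterlim_compose[OF lim m])
  then have "((\<lambda>y. Re (((g (of_real y) - g 0) / of_real y + (g (of_real (- y)) - g 0) / of_real (- y)) / (2 * \<i>)))
      \<longlongrightarrow> Re ((D * \<i> + D * \<i>) / (2 * \<i>))) (at_right 0)"
    by (rule tendsto_Re[OF tendsto_divide[OF _ tendsto_const]]) simp
  then have lim': "((\<lambda>y. Re (((g (of_real y) - g 0) / of_real y + (g (of_real (- y)) - g 0) / of_real (- y)) / (2 * \<i>)))
      \<longlongrightarrow> Re D) (at_right 0)"
    by simp
  have "0 \<le> Re (((g (of_real y) - g 0) / of_real y + (g (of_real (- y)) - g 0) / of_real (- y)) / (2 * \<i>))"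
    if "0 < y" for y
  proof -
    define z where "z = of_real x + \<i> * of_real y"
    \<comment> \<open>Because \<open>\<Omega> (cnj z)\<close> is the adjoint of
      \<open>\<Omega> z\<close>, this is the quadratic form of \<open>op_Im (\<Omega> z)\<close> at
      \<open>h\<close>.\<close>
    define W where "W = 1 / (2 * \<i>) * (f z - f (cnj z))"
    have z: "Im z = y" "z \<notin> \<real>" "cnj z = of_real x + \<i> * of_real (- y)"
      using that by (simp_all add: z_def complex_is_Real_iff)
    have "op_adjoint (\<Omega> z) = \<Omega> (cnj z)" "op_le 0 (Im z *\<^sub>R op_Im (\<Omega> z))"
      using \<Omega> z(2) by (auto simp: RS_def nevanlinna_def)
    then have "of_real y * W \<in> \<real>\<^sub>\<ge>\<^sub>0"
      by (simp add: W_def op_le_def op_Im_def z(1) f_def blinfun.scaleR_left blinfun.diff_left op_scaleC.rep_eq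
          cinner_scaleR_left cinner_scaleC_left cinner_diff_left)
    then have "0 \<le> Re W / y"
      using that by (simp add: complex_nonneg_Reals_iff zero_le_mult_iff)
    also have "\<dots> = Re (W / of_real y)"
      by simp
    also have "W / of_real y =
        ((g (of_real y) - g 0) / of_real y + (g (of_real (- y)) - g 0) / of_real (- y)) / (2 * \<i>)"
      unfolding g_def W_def z(3) z_def using that by (simp add: field_simps)
    finally show ?thesis .
  qed
  then show ?thesis
    by (intro tendsto_lowerbound[OF lim']) (auto simp: eventually_at_filter)
qed

lemma RS_form_mono:
  assumes \<Omega>: "\<Omega> \<in> RS" and xy: "x \<le> y" "\<bar>x\<bar> < 1" "\<bar>y\<bar> < 1"
  shows "Re (cinner (\<Omega> (of_real x) h) h) \<le> Re (cinner (\<Omega> (of_real y) h) h)"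
proof (rule DERIV_nonneg_imp_nondecreasing[OF xy(1), where f = "\<lambda>s. Re (cinner (\<Omega> (of_real s) h) h)"])
  fix t assume "x \<le> t" "t \<le> y"
  then have "of_real t \<in> slit_plane"
    using xy by simp
  then obtain D where D: "((\<lambda>z. cinner (\<Omega> z h) h) has_field_derivative D) (at (of_real t))"
    using RS_form_holomorphic[OF \<Omega>, of h] open_slit_plane
    by (metis DERIV_deriv_iff_field_differentiable holomorphic_on_imp_differentiable_at)
  then have "((\<lambda>s. cinner (\<Omega> (of_real s) h) h) has_vector_derivative D) (at t)"
    by (rule has_vector_derivative_real_field)
  then have "((\<lambda>s. Re (cinner (\<Omega> (of_real s) h) h)) has_vector_derivative Re D) (at t)"
    by (rule bounded_linear.has_vector_derivative[OF bounded_linear_Re])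
  then show "\<exists>d. ((\<lambda>s. Re (cinner (\<Omega> (of_real s) h) h)) has_real_derivative d) (at t) \<and> 0 \<le> d"
    using RS_form_deriv_nonneg[OF \<Omega> D] by (auto simp: has_real_derivative_iff_has_vector_derivative)
qed

text \<open>Each form is monotone with equal values at \<open>c\<close> and \<open>b\<close>, hence
  constant on the segment between them. The identity theorem extends this to the connected slit
  plane, and the forms determine the operator.\<close>

lemma RS_constant_if_eq_at_two_points:
  assumes \<Omega>: "\<Omega> \<in> RS" and b: "c < b" "\<bar>b\<bar> < 1" "\<bar>c\<bar> < 1"
    and eq: "\<Omega> (of_real b) = \<Omega> (of_real c)"
    and z: "z \<in> slit_plane"
  shows "\<Omega> z = \<Omega> (of_real c)"
proof (rule bounded_op_eqI_form)
  show "\<Omega> z \<in> bounded_ops" "\<Omega> (of_real c) \<in> bounded_ops"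
    using RS_bounded_ops[OF \<Omega>] z b by auto
  fix h
  let ?U = "complex_of_real ` {c..b}"
  have "cinner (\<Omega> z h) h - cinner (\<Omega> (of_real c) h) h = 0"
  proof (rule analytic_continuation[where f = "\<lambda>z. cinner (\<Omega> z h) h - cinner (\<Omega> (of_real c) h) h"])
    show "(\<lambda>z. cinner (\<Omega> z h) h - cinner (\<Omega> (of_real c) h) h) holomorphic_on slit_plane"
      by (intro holomorphic_intros RS_form_holomorphic \<Omega>)
    show "?U \<subseteq> slit_plane"
      using b by auto
    show "of_real c islimpt ?U"
    \<comment> \<open>A connected set with more than one point has no isolated point.\<close>
    proof (rule connected_imp_perfect)
      show "connected ?U"
        by (intro connected_continuous_image continuous_intros) simp
      have "of_real b \<in> ?U" "of_real c \<in> ?U"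
        using b by auto
      then show "?U \<noteq> {w}" for w
        using b(1) by (metis less_irrefl of_real_eq_iff singletonD)
    qed (use b in auto)
    fix w assume "w \<in> ?U"
    then obtain t where t: "w = of_real t" "c \<le> t" "t \<le> b"
      by auto
    have *: "cinner (\<Omega> (of_real s) h) h \<in> \<real>" if "\<bar>s\<bar> < 1" for s
      by (rule selfadjoint_contraction.form_real[OF RS_selfadjoint_contraction[OF \<Omega> that]])
    have t1: "\<bar>t\<bar> < 1"
      using t b by linarith
    have "Re (cinner (\<Omega> (of_real t) h) h) = Re (cinner (\<Omega> (of_real c) h) h)"
      using RS_form_mono[OF \<Omega>, of c t h] RS_form_mono[OF \<Omega>, of t b h] t t1 b eq by auto
    then show "cinner (\<Omega> w h) h - cinner (\<Omega> (of_real c) h) h = 0"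
      using *[OF t1] *[OF b(3)] t by (auto simp: complex_is_Real_iff complex_eq_iff)
  qed (use open_slit_plane connected_slit_plane z b in auto)
  then show "cinner (\<Omega> z h) h = cinner (\<Omega> (of_real c) h) h"
    by simp
qed

section \<open>Fundamental symmetries and the Moebius equation\<close>

lemma fundamental_symmetry_involution:
  assumes "fundamental_symmetry J"
  shows "J (J x) = x"
proof -
  obtain B where "is_op_inverse J B"
    using assms by (auto simp: fundamental_symmetry_def op_invertible_def)
  then have "is_op_inverse J J"
    using op_inverse_eqI assms unfolding fundamental_symmetry_def by metis
  then show ?thesis
    unfolding is_op_inverse_def by (metis blinfun_apply_blinfun_compose blinfun_apply_id_blinfun id_apply)
qed

text \<open>Since \<open>J\<close> squares to the identity, J - aI = J(I - aJ), and the factor I -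
  aJ cancels against its inverse.\<close>

lemma fundamental_symmetry_moebius_fixed:
  assumes J: "fundamental_symmetry J" and a: "\<bar>a\<bar> < 1"
  shows "(J - a *\<^sub>R id_blinfun) o\<^sub>L op_inverse (id_blinfun - a *\<^sub>R J) = J"
proof -
  note JJ = fundamental_symmetry_involution[OF J]
  have "a\<^sup>2 < 1"
    using a by (simp add: abs_square_less_1)
  \<comment> \<open>The inverse is explicit because (I - aJ)(I + aJ) is \<open>1 - a\<^sup>2\<close>
    times the identity.\<close>
  define B where "B = (1 / (1 - a\<^sup>2)) *\<^sub>R (id_blinfun + a *\<^sub>R J)"
  have B_apply: "B x = (1 / (1 - a\<^sup>2)) *\<^sub>R (x + a *\<^sub>R J x)" for x
    by (simp add: B_def blinfun.scaleR_left blinfun.add_left)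
  have scale: "(1 / (1 - a\<^sup>2)) *\<^sub>R (x - (a * a) *\<^sub>R x) = x" for x :: 'a
  proof -
    have "x - (a * a) *\<^sub>R x = (1 - a\<^sup>2) *\<^sub>R x"
      by (simp add: scaleR_left_diff_distrib power2_eq_square)
    then show ?thesis
      using \<open>a\<^sup>2 < 1\<close> by simp
  qed
  have left: "B (x - a *\<^sub>R J x) = x" for x
    using scale[of x] by (simp add: B_apply blinfun.diff_right blinfun.scaleR_right JJ algebra_simps)
  have right: "B x - a *\<^sub>R J (B x) = x" for x
    using scale[of x]
    by (simp add: B_apply blinfun.add_right blinfun.scaleR_right JJ scaleR_right_distrib
        scaleR_right_diff_distrib mult.commute mult.left_commute)
  have "is_op_inverse (id_blinfun - a *\<^sub>R J) B"
    unfolding is_op_inverse_def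
  proof (intro conjI)
    show "B \<in> bounded_ops"
      unfolding B_def using J
      by (auto simp: fundamental_symmetry_def intro!: scaleR_bounded_ops add_bounded_ops id_bounded_ops)
  qed (auto simp: blinfun.diff_left blinfun.scaleR_left left right intro!: blinfun_eqI)
  then have inv: "op_inverse (id_blinfun - a *\<^sub>R J) = B"
    by (rule op_inverse_eqI)
  show ?thesis
  proof (rule blinfun_eqI)
    fix x
    have "J x = J (B x - a *\<^sub>R J (B x))"
      by (simp add: right)
    then show "((J - a *\<^sub>R id_blinfun) o\<^sub>L op_inverse (id_blinfun - a *\<^sub>R J)) x = J x"
      by (simp add: inv blinfun.diff_left blinfun.diff_right blinfun.scaleR_left blinfun.scaleR_right JJ)
  qed
qed

lemma RS_moebius_fixed_imp_symmetry:
  assumes \<Omega>: "\<Omega> \<in> RS" and a: "\<bar>a\<bar> < 1" "a \<noteq> 0"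
    and eq: "\<Omega> (of_real a) = (\<Omega> 0 - a *\<^sub>R id_blinfun) o\<^sub>L op_inverse (id_blinfun - a *\<^sub>R \<Omega> 0)"
  shows "fundamental_symmetry (\<Omega> 0) \<and> (\<forall>z\<in>slit_plane. \<Omega> z = \<Omega> 0)"
proof -
  define T where "T = \<Omega> 0"
  define S where "S = \<Omega> (of_real a)"
  interpret selfadjoint_contraction T
    using RS_selfadjoint_contraction[OF \<Omega>, of 0] by (simp add: T_def)
  obtain R where R: "is_op_inverse (id_blinfun - a *\<^sub>R T) R"
    using resolvent_invertible[OF a(1)] unfolding op_invertible_def by blast
  have "S = (T - a *\<^sub>R id_blinfun) o\<^sub>L R"
    using eq op_inverse_eqI[OF R] by (simp add: S_def T_def)
  moreover have "R (u - a *\<^sub>R T u) = u" for u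
  proof -
    have "(R o\<^sub>L (id_blinfun - a *\<^sub>R T)) u = u"
      using R by (simp add: is_op_inverse_def)
    then show ?thesis
      by (simp add: blinfun.diff_left blinfun.scaleR_left)
  qed
  ultimately have S: "S (u - a *\<^sub>R T u) = T u - a *\<^sub>R u" for u
    by (simp add: blinfun.diff_left blinfun.scaleR_left)
  have "T (T u) = u" for u
  proof (rule involution_if_defect_nonpos[OF a(1)])
    fix u
    \<comment> \<open>On vectors of the form (I - aT)u the inverse in the formula for
      \<open>S\<close> cancels, so S - T is evaluated through \<open>T\<close> alone.\<close>
    define h where "h = u - a *\<^sub>R T u"
    have "S h - T h = - (a *\<^sub>R (u - T (T u)))"
      unfolding h_def S by (simp add: blinfun.diff_right blinfun.scaleR_right algebra_simps)
    then have "cinner (S h - T h) h = - (of_real a * cinner (u - T (T u)) h)"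
      by (simp only: cinner_minus_left cinner_scaleR_left)
    from arg_cong[OF this, of Re]
    have diff: "Re (cinner (S h) h) - Re (cinner (T h) h) = - (a * Re (cinner (u - T (T u)) h))"
      by (simp add: cinner_diff_left[of "S h"])
    show "Re (cinner (u - T (T u)) h) \<le> 0"
    \<comment> \<open>The sign of \<open>a\<close> decides the order of 0 and \<open>a\<close>,
      hence the sign of the form of S - T. In both cases dividing by \<open>a\<close> yields the
      same inequality.\<close>
    proof (cases "0 < a")
      case True
      then have "a * Re (cinner (u - T (T u)) h) \<le> 0"
        using RS_form_mono[OF \<Omega>, of 0 a h] a diff by (simp add: S_def T_def)
      then show ?thesis
        using True by (simp add: mult_le_0_iff)
    next
      case False
      then have "0 \<le> a * Re (cinner (u - T (T u)) h)"
        using RS_form_mono[OF \<Omega>, of a 0 h] a diff by (simp add: S_def T_def)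
      then show ?thesis
        using False a by (simp add: zero_le_mult_iff)
    qed
  qed
  then have sym: "fundamental_symmetry T"
    by (rule fundamental_symmetry_if_involution)
  \<comment> \<open>The equation presents \<open>S\<close> as the Moebius transform of
    \<open>T\<close>, which fixes a fundamental symmetry.\<close>
  then have "S = T"
    using fundamental_symmetry_moebius_fixed[OF sym a(1)] eq by (simp add: S_def T_def)
  then have "\<Omega> z = T" if "z \<in> slit_plane" for z
    using RS_constant_if_eq_at_two_points[OF \<Omega>, of a 0 z]
      RS_constant_if_eq_at_two_points[OF \<Omega>, of 0 a z] that a
    by (cases "0 < a") (auto simp: S_def T_def)
  then show ?thesis
    using sym by (simp add: T_def)
qed

theorem theorem6p19:
  fixes \<Omega> :: "complex \<Rightarrow> ('a::chilbert_space \<Rightarrow>\<^sub>L 'a)" and a :: real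
  assumes "separable_space (euclidean :: 'a topology)"
    and "a \<in> {-1<..<1}" and "a \<noteq> 0"
    and "\<Omega> \<in> RS"
  shows "(\<forall>z\<in>slit_plane.
            \<Omega> z = (\<Omega> ((z - of_real a) / (1 - of_real a * z)) - a *\<^sub>R id_blinfun) o\<^sub>L
                  op_inverse (id_blinfun - a *\<^sub>R \<Omega> ((z - of_real a) / (1 - of_real a * z))))
         \<longleftrightarrow> (\<exists>J. fundamental_symmetry J \<and> (\<forall>z\<in>slit_plane. \<Omega> z = J))"
    (is "?eq \<longleftrightarrow> ?sym")
proof
  have a: "\<bar>a\<bar> < 1"
    using assms(2) by auto
  {
    assume eq: ?eq
    \<comment> \<open>At z = a the inner argument (z - a)/(1 - az) is 0.\<close>
    have "of_real a \<in> slit_plane"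
      using a by simp
    from bspec[OF eq this]
    have "\<Omega> (of_real a) = (\<Omega> 0 - a *\<^sub>R id_blinfun) o\<^sub>L op_inverse (id_blinfun - a *\<^sub>R \<Omega> 0)"
      by simp
    then show ?sym
      using RS_moebius_fixed_imp_symmetry[OF assms(4) a assms(3)] by blast
  next
    assume ?sym
    then obtain J where J: "fundamental_symmetry J" "\<And>z. z \<in> slit_plane \<Longrightarrow> \<Omega> z = J"
      by blast
    \<comment> \<open>The inner argument stays in the slit plane, so both occurrences of
      \<open>\<Omega>\<close> on the right equal \<open>J\<close>.\<close>
    show ?eq
      using J(2) moebius_slit_plane[OF a] fundamental_symmetry_moebius_fixed[OF J(1) a] by simp
  }
qed

end
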